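(* There is a constant $D$ such that for any positive integers $m\le n$ there exists a connected graph $G$ with $\Delta(G)\le D$, $\mathrm{def}_c(G)=m$ and $\mathrm{def}(G)=n$.
   Context: All graphs are finite, simple and undirected. A proper $t$-edge coloring of $G$ is a map $\alpha:E(G)\to\{1,\dots,t\}$ giving adjacent edges distinct colors; $S(v,\alpha)$ denotes the set of colors on edges incident to $v$. An interval $t$-coloring is a proper $t$-edge coloring in which $S(v,\alpha)$ is an interval of integers for every vertex $v$. A set $A\subseteq\{1,\dots,t\}$ is a cyclic interval modulo $t$ if $A$ or $\{1,\dots,t\}\setminus A$ is an interval of integers; a cyclic interval $t$-coloring is a proper $t$-edge coloring with $S(v,\alpha)$ a cyclic interval modulo $t$ at every vertex. The deficiency $\mathrm{def}(G)$ is the minimum number of pendant edges whose attachment to $G$ yields a graph admitting an interval coloring. The cyclic deficiency $\mathrm{def}_c(G)$ is the minimum number of pendant edges whose attachment to $G$ yields a graph admitting a cyclic interval coloring (equivalently, the minimum over proper edge colorings $\alpha$ of $G$, with any number $t$ of colors, of $\sum_v$ (the minimum number of positive integers that must be added to $S(v,\alpha)$ to make it a cyclic interval modulo $t$)). $\Delta(G)$ is the maximum degree. *)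

theory Defs
  imports Main
begin

datatype 'a graph = Graph (verts: "'a set") (edges: "'a set set")

definition simple_graph :: "'a graph \<Rightarrow> bool" where
  "simple_graph G \<longleftrightarrow> finite (verts G) \<and> (\<forall>e\<in>edges G. e \<subseteq> verts G \<and> card e = 2)"

definition degree :: "'a graph \<Rightarrow> 'a \<Rightarrow> nat" where
  "degree G v = card {e \<in> edges G. v \<in> e}"

(* Meaningful only for graphs with at least one vertex, as Max {} is unspecified. *)
definition max_degree :: "'a graph \<Rightarrow> nat" where
  "max_degree G = Max (degree G ` verts G)"

definition connected_graph :: "'a graph \<Rightarrow> bool" where
  "connected_graph G \<longleftrightarrow> verts G \<noteq> {} \<and>
     (\<forall>u\<in>verts G. \<forall>v\<in>verts G. (u, v) \<in> {(x, y). {x, y} \<in> edges G}\<^sup>*)"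

(* Not every one of the t colors has to be used. *)
definition proper_edge_coloring :: "'a graph \<Rightarrow> nat \<Rightarrow> ('a set \<Rightarrow> nat) \<Rightarrow> bool" where
  "proper_edge_coloring G t \<alpha> \<longleftrightarrow> \<alpha> ` edges G \<subseteq> {1..t} \<and>
     (\<forall>e\<in>edges G. \<forall>f\<in>edges G. e \<noteq> f \<and> e \<inter> f \<noteq> {} \<longrightarrow> \<alpha> e \<noteq> \<alpha> f)"

definition spectrum :: "'a graph \<Rightarrow> ('a set \<Rightarrow> nat) \<Rightarrow> 'a \<Rightarrow> nat set" where
  "spectrum G \<alpha> v = \<alpha> ` {e \<in> edges G. v \<in> e}"

(* The empty set counts as an interval (take b < a): it is the set of colors at an
   isolated vertex, and the complement of the full set of colors. *)
definition int_interval :: "nat set \<Rightarrow> bool" where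
  "int_interval A \<longleftrightarrow> (\<exists>a b. A = {a..b})"

definition cyclic_interval :: "nat \<Rightarrow> nat set \<Rightarrow> bool" where
  "cyclic_interval t A \<longleftrightarrow> A \<subseteq> {1..t} \<and> (int_interval A \<or> int_interval ({1..t} - A))"

definition interval_coloring :: "'a graph \<Rightarrow> nat \<Rightarrow> ('a set \<Rightarrow> nat) \<Rightarrow> bool" where
  "interval_coloring G t \<alpha> \<longleftrightarrow> proper_edge_coloring G t \<alpha> \<and>
     (\<forall>v\<in>verts G. int_interval (spectrum G \<alpha> v))"

definition cyclic_interval_coloring :: "'a graph \<Rightarrow> nat \<Rightarrow> ('a set \<Rightarrow> nat) \<Rightarrow> bool" where
  "cyclic_interval_coloring G t \<alpha> \<longleftrightarrow> proper_edge_coloring G t \<alpha> \<and>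
     (\<forall>v\<in>verts G. cyclic_interval t (spectrum G \<alpha> v))"

(* The graph obtained from G by attaching k pendant edges, the i-th one (i < k) joining
   the vertex p i of G to a new vertex Inr i. Several of them may be attached at the
   same vertex of G. *)
definition attach_pendants :: "'a graph \<Rightarrow> nat \<Rightarrow> (nat \<Rightarrow> 'a) \<Rightarrow> ('a + nat) graph" where
  "attach_pendants G k p = Graph
     (Inl ` verts G \<union> Inr ` {..<k})
     ((\<lambda>e. Inl ` e) ` edges G \<union> (\<lambda>i. {Inl (p i), Inr i}) ` {..<k})"

(* In both definitions below a suitable k exists for every finite simple graph: take a
   proper edge coloring and fill the gaps in the color set of each vertex. *)
definition deficiency :: "'a graph \<Rightarrow> nat" where
  "deficiency G = (LEAST k. \<exists>p t \<alpha>. (\<forall>i<k. p i \<in> verts G) \<and>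
     interval_coloring (attach_pendants G k p) t \<alpha>)"

definition cyclic_deficiency :: "'a graph \<Rightarrow> nat" where
  "cyclic_deficiency G = (LEAST k. \<exists>p t \<alpha>. (\<forall>i<k. p i \<in> verts G) \<and>
     cyclic_interval_coloring (attach_pendants G k p) t \<alpha>)"

end

theory Submission
  imports Defs
begin

text \<open>The graph is a chain of \<open>n\<close> blocks, in each of which a gadget hangs on the rest by a bridge. The
  first \<open>m\<close> gadgets are a \<open>K\<^sub>4\<close> with one edge subdivided (the bridge starts at the subdivision vertex), the
  others are a \<open>K\<^sub>5\<close>. Neither type fits into an interval coloring without a pendant edge of its
  own: in the \<open>K\<^sub>5\<close>, an interval coloring would put every residue class modulo 4 exactly once at the
  four vertices off the bridge; some class not containing the bridge also occurs exactly once at the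
  fifth vertex, so it would be a perfect matching of five vertices. The subdivided \<open>K\<^sub>4\<close> does not even
  fit into a cyclic interval coloring with six or more colors, and a vertex of degree six in every
  block excludes fewer colors. With seven colors the \<open>K\<^sub>5\<close> gadget has a cyclic interval coloring,
  and one pendant edge makes either gadget interval colorable. A pendant edge helps at most the block
  it is attached to, so the two deficiencies are \<open>m\<close> and \<open>n\<close>.\<close>

section \<open>Attaching pendant edges\<close>

text \<open>Leaves the condition on color sets open, so that the lower and upper bounds for both
  deficiencies come from the same lemmas.\<close>

definition completable :: "(nat \<Rightarrow> nat set \<Rightarrow> bool) \<Rightarrow> 'a graph \<Rightarrow> nat \<Rightarrow> bool" where
  "completable P G k \<longleftrightarrow> (\<exists>p t \<alpha>. (\<forall>i<k. p i \<in> verts G) \<and>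
     proper_edge_coloring (attach_pendants G k p) t \<alpha> \<and>
     (\<forall>v\<in>verts (attach_pendants G k p). P t (spectrum (attach_pendants G k p) \<alpha> v)))"

lemma deficiency_completable:
  "deficiency G = (LEAST k. completable (\<lambda>_. int_interval) G k)"
  unfolding deficiency_def completable_def interval_coloring_def ..

lemma cyclic_deficiency_completable:
  "cyclic_deficiency G = (LEAST k. completable cyclic_interval G k)"
  unfolding cyclic_deficiency_def completable_def cyclic_interval_coloring_def ..

lemma proper_edge_coloring_iff_inj_on:
  assumes "\<And>e. e \<in> edges G \<Longrightarrow> e \<subseteq> verts G"
  shows "proper_edge_coloring G t \<alpha> \<longleftrightarrow> \<alpha> ` edges G \<subseteq> {1..t} \<and>
    (\<forall>v\<in>verts G. inj_on \<alpha> {e \<in> edges G. v \<in> e})"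
  using assms unfolding proper_edge_coloring_def inj_on_def by fast

lemma incident_edges_attach_pendants:
  "{e \<in> edges (attach_pendants G k p). Inl v \<in> e} =
     (`) Inl ` {e \<in> edges G. v \<in> e} \<union> (\<lambda>i. {Inl (p i), Inr i}) ` {i. i < k \<and> p i = v}"
  by (auto simp: attach_pendants_def)

text \<open>Pigeonhole: fewer than \<open>n\<close> pendant edges miss one of the \<open>n\<close>
  blocks. At the vertices of that block the color sets are those of the coloring restricted to
  \<open>G\<close>, and one of them violates \<open>P\<close>.\<close>

lemma not_completable:
  fixes blk :: "'a \<Rightarrow> nat"
  assumes bad: "\<And>t \<alpha> b. proper_edge_coloring G t \<alpha> \<Longrightarrow> b < n \<Longrightarrow>
      \<exists>v\<in>verts G. blk v = b \<and> \<not> P t (spectrum G \<alpha> v)"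
    and "k < n"
  shows "\<not> completable P G k"
proof
  assume "completable P G k"
  then obtain p t \<alpha> where
    proper: "proper_edge_coloring (attach_pendants G k p) t \<alpha>" and
    P: "\<And>v. v \<in> verts (attach_pendants G k p) \<Longrightarrow> P t (spectrum (attach_pendants G k p) \<alpha> v)"
    unfolding completable_def by blast
  define \<beta> where "\<beta> = (\<lambda>e. \<alpha> (Inl ` e))"
  have edge: "Inl ` e \<in> edges (attach_pendants G k p)" if "e \<in> edges G" for e
    using that by (simp add: attach_pendants_def)
  have neq: "Inl ` e \<noteq> (Inl ` f :: ('a + nat) set) \<and> Inl ` e \<inter> (Inl ` f :: ('a + nat) set) \<noteq> {}"
    if "e \<noteq> f" "e \<inter> f \<noteq> {}" for e f :: "'a set"
    using that by (auto simp: inj_image_eq_iff)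
  have "proper_edge_coloring G t \<beta>"
    unfolding proper_edge_coloring_def
  proof (intro conjI ballI impI)
    show "\<beta> ` edges G \<subseteq> {1..t}"
      using proper edge unfolding proper_edge_coloring_def \<beta>_def by blast
    show "\<beta> e \<noteq> \<beta> f" if "e \<in> edges G" "f \<in> edges G" "e \<noteq> f \<and> e \<inter> f \<noteq> {}" for e f
      using proper[unfolded proper_edge_coloring_def, THEN conjunct2, rule_format,
          OF edge[OF that(1)] edge[OF that(2)] neq[OF conjunct1[OF that(3)] conjunct2[OF that(3)]]]
      by (simp add: \<beta>_def)
  qed
  have "card ((\<lambda>i. blk (p i)) ` {..<k}) < card {..<n}"
    using card_image_le[of "{..<k}" "\<lambda>i. blk (p i)"] \<open>k < n\<close> by simp
  then have "\<not> {..<n} \<subseteq> (\<lambda>i. blk (p i)) ` {..<k}"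
    using card_mono[of "(\<lambda>i. blk (p i)) ` {..<k}" "{..<n}"] by auto
  then obtain b where b: "b < n" "\<And>i. i < k \<Longrightarrow> blk (p i) \<noteq> b"
    by auto
  from bad[OF \<open>proper_edge_coloring G t \<beta>\<close> b(1)]
  obtain v where v: "v \<in> verts G" "blk v = b" "\<not> P t (spectrum G \<beta> v)"
    by blast
  have "{i. i < k \<and> p i = v} = {}"
    using b(2) v(2) by auto
  then have "spectrum (attach_pendants G k p) \<alpha> (Inl v) = spectrum G \<beta> v"
    unfolding spectrum_def incident_edges_attach_pendants \<beta>_def
    by (simp only: image_empty Un_empty_right image_image)
  moreover have "Inl v \<in> verts (attach_pendants G k p)"
    using v(1) by (simp add: attach_pendants_def)
  ultimately show False
    using P v(3) by metis
qed

text \<open>One color \<open>q\<close> serves all pendant edges, since they sit at distinct vertices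
  where \<open>q\<close> is free. The new leaves have the color set \<open>{q}\<close>.\<close>

lemma completableI:
  assumes simple: "simple_graph G"
    and proper: "proper_edge_coloring G t \<alpha>"
    and p: "\<And>i. i < k \<Longrightarrow> p i \<in> verts G" "inj_on p {..<k}"
    and q: "q \<in> {1..t}" "\<And>i. i < k \<Longrightarrow> q \<notin> spectrum G \<alpha> (p i)"
    and P: "\<And>v. v \<in> verts G \<Longrightarrow>
      P t (spectrum G \<alpha> v \<union> (if v \<in> p ` {..<k} then {q} else {}))"
    and single: "P t {q}"
  shows "completable P G k"
proof -
  let ?H = "attach_pendants G k p"
  \<comment> \<open>The edges of \<open>G\<close> are those without an end \<open>Inr i\<close>;
    they are pulled back along \<open>Inl\<close>.\<close>
  define \<beta> :: "('a + nat) set \<Rightarrow> nat"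
    where "\<beta> = (\<lambda>e. if Inr ` UNIV \<inter> e = {} then \<alpha> (Inl -` e) else q)"
  have \<beta>_Inl: "\<beta> (Inl ` e) = \<alpha> e" for e
  proof -
    have "Inr ` UNIV \<inter> Inl ` e = ({} :: ('a + nat) set)" "Inl -` (Inl ` e :: ('a + nat) set) = e"
      by auto
    then show ?thesis by (simp add: \<beta>_def)
  qed
  have \<beta>_pendant: "\<beta> {Inl x, Inr i} = q" for x i
    by (auto simp: \<beta>_def)
  have sub: "e \<subseteq> verts ?H" if "e \<in> edges ?H" for e
  proof -
    from that consider f where "e = Inl ` f" "f \<in> edges G" | i where "e = {Inl (p i), Inr i}" "i < k"
      by (auto simp: attach_pendants_def)
    then show ?thesis
    proof cases
      case 1
      then have "f \<subseteq> verts G"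
        using simple by (simp add: simple_graph_def)
      then show ?thesis
        using 1(1) by (auto simp: attach_pendants_def)
    next
      case 2
      then show ?thesis
        using p(1) by (auto simp: attach_pendants_def)
    qed
  qed
  have propG: "\<alpha> ` edges G \<subseteq> {1..t}" "\<And>v. v \<in> verts G \<Longrightarrow> inj_on \<alpha> {e \<in> edges G. v \<in> e}"
    using proper proper_edge_coloring_iff_inj_on[of G t \<alpha>] simple
    unfolding simple_graph_def by blast+
  have pend: "{i. i < k \<and> p i = v} = (if v \<in> p ` {..<k} then {the_inv_into {..<k} p v} else {})" for v
    using the_inv_into_f_f[OF p(2)] by (auto dest: inj_onD[OF p(2)])
  have spec_Inl: "spectrum ?H \<beta> (Inl v) = spectrum G \<alpha> v \<union> (if v \<in> p ` {..<k} then {q} else {})" for v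
    unfolding spectrum_def incident_edges_attach_pendants image_Un image_image pend
    by (simp add: \<beta>_Inl \<beta>_pendant)
  have inc_Inr: "{e \<in> edges ?H. Inr i \<in> e} = {{Inl (p i), Inr i}}" if "i < k" for i
    using that by (auto simp: attach_pendants_def)
  have spec_Inr: "spectrum ?H \<beta> (Inr i) = {q}" if "i < k" for i
    unfolding spectrum_def inc_Inr[OF that] by (simp add: \<beta>_pendant)
  have "proper_edge_coloring ?H t \<beta>"
  proof (rule proper_edge_coloring_iff_inj_on[THEN iffD2], erule sub, intro conjI ballI)
    show "\<beta> ` edges ?H \<subseteq> {1..t}"
      using propG(1) q(1) by (auto simp: attach_pendants_def \<beta>_Inl \<beta>_pendant)
    show "inj_on \<beta> {e \<in> edges ?H. v \<in> e}" if "v \<in> verts ?H" for v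
    proof (cases v)
      case (Inr i)
      then have "i < k" using that by (auto simp: attach_pendants_def)
      then show ?thesis using inc_Inr Inr by simp
    next
      case (Inl x)
      then have "x \<in> verts G" using that by (auto simp: attach_pendants_def)
      have "inj_on \<beta> ((`) Inl ` {e \<in> edges G. x \<in> e})"
        using propG(2)[OF \<open>x \<in> verts G\<close>] by (auto simp: inj_on_def \<beta>_Inl)
      moreover have "q \<notin> \<beta> ` (`) Inl ` {e \<in> edges G. x \<in> e}" if "x \<in> p ` {..<k}"
        using q(2) that unfolding image_image \<beta>_Inl spectrum_def by auto
      ultimately show ?thesis
        unfolding Inl incident_edges_attach_pendants inj_on_Un pend
        by (auto simp: \<beta>_pendant image_iff split: if_splits)
    qed
  qed
  moreover have "P t (spectrum ?H \<beta> v)" if "v \<in> verts ?H" for v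
    using that P spec_Inl spec_Inr single by (auto simp: attach_pendants_def)
  ultimately show ?thesis
    unfolding completable_def using p(1) by blast
qed

section \<open>Chains of blocks\<close>

text \<open>The gadget occupies the vertices 2 to 6 and hangs on the vertex 1 of degree at least six. In the
  chain, vertex 1 of each block is joined to vertex 0 of the next one. If \<open>cubic\<close> holds, all
  vertices of the gadget have degree three, counting the bridge.\<close>

definition block_edges :: "bool \<Rightarrow> (nat \<times> nat) list" where
  "block_edges cubic = [(0,1),(1,2),(1,7),(1,8),(1,9),(1,10)] @
     (if cubic then [(2,3),(2,4),(3,5),(3,6),(4,5),(4,6),(5,6)]
      else [(2,3),(2,4),(2,5),(2,6),(3,4),(3,5),(3,6),(4,5),(4,6),(5,6)])"

definition block_nbrs :: "bool \<Rightarrow> nat \<Rightarrow> nat list" where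
  "block_nbrs cubic x =
     map snd (filter (\<lambda>e. fst e = x) (block_edges cubic)) @
     map fst (filter (\<lambda>e. snd e = x) (block_edges cubic))"

text \<open>Vertex \<open>x\<close> of block \<open>i\<close> is the number
  \<open>11 * i + x\<close>, so that \<open>div 11\<close> and \<open>mod 11\<close> recover the
  block and the position. The first \<open>m\<close> blocks carry the cubic gadget.\<close>

definition chain :: "nat \<Rightarrow> nat \<Rightarrow> nat graph" where
  "chain m n = Graph {..<11 * n}
     ({{11 * i + x, 11 * i + y} |i x y. i < n \<and> (x, y) \<in> set (block_edges (i < m))} \<union>
      {{11 * i + 1, 11 * i + 11} |i. Suc i < n})"

text \<open>The last two lists belong to the connecting edges: \<open>11 * i + 11\<close> is vertex
  0 of the next block, and \<open>11 * i - 10\<close> is vertex 1 of the previous one.\<close>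

definition chain_nbrs :: "nat \<Rightarrow> nat \<Rightarrow> nat \<Rightarrow> nat \<Rightarrow> nat list" where
  "chain_nbrs m n i x = map (\<lambda>y. 11 * i + y) (block_nbrs (i < m) x) @
     (if x = 1 \<and> Suc i < n then [11 * i + 11] else []) @
     (if x = 0 \<and> 0 < i then [11 * i - 10] else [])"

(* This simproc fails with an error on the conditional singleton lists above. *)
declare [[simproc del: list_to_set_comprehension]]

lemma chain_nbrsI: "y \<in> set (block_nbrs (i < m) x) \<Longrightarrow> 11 * i + y \<in> set (chain_nbrs m n i x)"
  unfolding chain_nbrs_def set_append set_map by blast

lemma chain_nbrs_succI: "Suc i < n \<Longrightarrow> 11 * i + 11 \<in> set (chain_nbrs m n i 1)"
  unfolding chain_nbrs_def set_append by (intro UnI2 UnI1) simp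

lemma chain_nbrs_predI: "11 * i + 1 \<in> set (chain_nbrs m n (Suc i) 0)"
  unfolding chain_nbrs_def set_append by (intro UnI2) simp

lemma block_edges_less: "(x, y) \<in> set (block_edges b) \<Longrightarrow> x < y \<and> y < 11"
  by (auto simp: block_edges_def split: if_splits)

lemma set_block_nbrs:
  "set (block_nbrs b x) = {y. (x, y) \<in> set (block_edges b) \<or> (y, x) \<in> set (block_edges b)}"
  by (force simp: block_nbrs_def)

lemma block_nbrs_less: "y \<in> set (block_nbrs b x) \<Longrightarrow> y < 11 \<and> y \<noteq> x"
  using block_edges_less by (fastforce simp: set_block_nbrs)

lemma block_nbrs_smaller:
  assumes "0 < x" "x < 11"
  shows "\<exists>y\<in>set (block_nbrs b x). y < x"
proof -
  have "\<forall>x\<in>{1,2,3,4,5,6,7,8,9,10}. \<exists>y\<in>set (block_nbrs b x). y < x"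
    by (cases b) (simp_all add: block_nbrs_def block_edges_def)
  moreover have "x \<in> {1,2,3,4,5,6,7,8,9,10}"
    using assms by (simp; presburger)
  ultimately show ?thesis
    by blast
qed

lemma block_index_eq:
  fixes x y :: nat
  assumes "x < 11" "y < 11"
  shows "11 * i + x = 11 * j + y \<longleftrightarrow> i = j \<and> x = y"
  using assms by presburger

lemma simple_chain: "simple_graph (chain m n)"
proof -
  have "e \<subseteq> verts (chain m n) \<and> card e = 2" if "e \<in> edges (chain m n)" for e
    using that by (auto simp: chain_def card_insert_if dest!: block_edges_less)
  then show ?thesis
    by (simp add: simple_graph_def chain_def)
qed

text \<open>Degrees, properness and color sets in the chain can thus be read off explicit neighbour
  lists.\<close>

lemma incident_chain:
  assumes "i < n" "x < 11"
  shows "{e \<in> edges (chain m n). 11 * i + x \<in> e} = (\<lambda>w. {11 * i + x, w}) ` set (chain_nbrs m n i x)"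
    (is "?L = ?R")
proof
  show "?L \<subseteq> ?R"
  proof
    fix e assume "e \<in> ?L"
    then consider (block) j y z where "e = {11 * j + y, 11 * j + z}" "(y, z) \<in> set (block_edges (j < m))"
        "11 * i + x \<in> e"
      | (link) j where "e = {11 * j + 1, 11 * j + 11}" "Suc j < n" "11 * i + x \<in> e"
      by (auto simp: chain_def)
    then show "e \<in> ?R"
    proof cases
      case block
      then have "i = j \<and> (x = y \<or> x = z)"
        using assms block_edges_less[OF block(2)] block_index_eq[of x y i j] block_index_eq[of x z i j]
        by auto
      then have "e = {11 * i + x, 11 * i + z} \<and> z \<in> set (block_nbrs (i < m) x) \<or>
          e = {11 * i + x, 11 * i + y} \<and> y \<in> set (block_nbrs (i < m) x)"
        using block(1,2) by (auto simp: set_block_nbrs)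
      then obtain z' where "e = {11 * i + x, 11 * i + z'}" "z' \<in> set (block_nbrs (i < m) x)"
        by blast
      then show ?thesis
        using chain_nbrsI by blast
    next
      case link
      then have "i = j \<and> x = 1 \<or> i = Suc j \<and> x = 0"
        using assms block_index_eq[of x 1 i j] block_index_eq[of x 0 i "Suc j"] by auto
      then show ?thesis
      proof (elim disjE conjE)
        assume "i = j" "x = 1"
        then show ?thesis
          using link(1,2) chain_nbrs_succI by blast
      next
        assume eq: "i = Suc j" "x = 0"
        then have "e = {11 * i + x, 11 * j + 1}"
          unfolding link(1) by (simp add: insert_commute add.commute)
        then show ?thesis
          using chain_nbrs_predI[of j m n] eq by blast
      qed
    qed
  qed
  show "?R \<subseteq> ?L"
  proof
    fix e assume "e \<in> ?R"
    then obtain w where e: "e = {11 * i + x, w}" and w: "w \<in> set (chain_nbrs m n i x)"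
      by blast
    from w consider (block) "w \<in> (\<lambda>y. 11 * i + y) ` set (block_nbrs (i < m) x)"
      | (succ) "w \<in> set (if x = 1 \<and> Suc i < n then [11 * i + 11] else [])"
      | (pred) "w \<in> set (if x = 0 \<and> 0 < i then [11 * i - 10] else [])"
      unfolding chain_nbrs_def set_append set_map by blast
    then show "e \<in> ?L"
    proof cases
      case block
      then obtain y where y: "w = 11 * i + y" "y \<in> set (block_nbrs (i < m) x)"
        by blast
      then have "e = {11 * i + x, 11 * i + y}" "e = {11 * i + y, 11 * i + x}"
        using e by auto
      then have "e \<in> edges (chain m n)"
        using y(2) assms(1) unfolding set_block_nbrs chain_def by fastforce
      then show ?thesis
        using e by blast
    next
      case succ
      then have "x = 1 \<and> Suc i < n \<and> w = 11 * i + 11"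
        by (simp split: if_splits)
      then show ?thesis
        using e by (auto simp: chain_def)
    next
      case pred
      then have pred': "x = 0 \<and> 0 < i \<and> w = 11 * i - 10"
        by (simp split: if_splits)
      then obtain j where j: "i = Suc j"
        by (cases i) auto
      then have "e = {11 * j + 1, 11 * j + 11}" "Suc j < n"
        using e assms pred' by (simp_all add: insert_commute add.commute)
      then show ?thesis
        using e by (auto simp: chain_def)
    qed
  qed
qed

lemma inj_on_doubleton: "inj_on (\<lambda>w. {v, w}) A"
  by (auto simp: inj_on_def doubleton_eq_iff)

lemma inj_on_chain_nbrs:
  assumes "i < n" "x < 11"
  shows "inj_on \<alpha> {e \<in> edges (chain m n). 11 * i + x \<in> e} \<longleftrightarrow>
    inj_on (\<lambda>w. \<alpha> {11 * i + x, w}) (set (chain_nbrs m n i x))"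
  using comp_inj_on_iff[OF inj_on_doubleton, of \<alpha> "11 * i + x" "set (chain_nbrs m n i x)"]
  by (simp add: incident_chain[OF assms] comp_def)

lemma spectrum_chain:
  assumes "i < n" "x < 11"
  shows "spectrum (chain m n) \<alpha> (11 * i + x) =
    (\<lambda>w. \<alpha> {11 * i + x, w}) ` set (chain_nbrs m n i x)"
  by (simp add: spectrum_def incident_chain[OF assms] image_image)

lemma chain_vertexE:
  assumes "v \<in> verts (chain m n)"
  obtains i x where "v = 11 * i + x" "i < n" "x < 11"
proof
  show "v = 11 * (v div 11) + v mod 11" "v div 11 < n" "v mod 11 < 11"
    using assms by (auto simp: chain_def)
qed

text \<open>Every vertex other than 0 has a smaller neighbour, either in its block or, at the start
  of a block, in the previous one. Descending along these reaches 0.\<close>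

lemma connected_chain:
  assumes "0 < n"
  shows "connected_graph (chain m n)"
proof -
  let ?R = "{(x, y). {x, y} \<in> edges (chain m n)}"
  have "(0, v) \<in> ?R\<^sup>*" if "v \<in> verts (chain m n)" for v
    using that
  proof (induction v rule: less_induct)
    case (less v)
    show ?case
    proof (cases "v = 0")
      case False
      obtain i x where v: "v = 11 * i + x" "i < n" "x < 11"
        using chain_vertexE[OF less.prems] .
      have "\<exists>w\<in>set (chain_nbrs m n i x). w < v"
      proof (cases "x = 0")
        case True
        then show ?thesis
          using v False by (auto simp: chain_nbrs_def)
      next
        case False
        then obtain y where y: "y \<in> set (block_nbrs (i < m) x)" "y < x"
          using block_nbrs_smaller v(3) by blast
        then have "11 * i + y < v"
          using v(1) by simp
        then show ?thesis
          using chain_nbrsI[OF y(1)] by blast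
      qed
      then obtain w where w: "w \<in> set (chain_nbrs m n i x)" "w < v"
        by blast
      then have "{v, w} \<in> edges (chain m n)"
        using incident_chain[OF v(2,3)] v(1) by blast
      moreover have "w \<in> verts (chain m n)"
        using w(2) less.prems by (simp add: chain_def)
      ultimately show ?thesis
        using less.IH[OF w(2)] by (auto intro: rtrancl_into_rtrancl simp: insert_commute)
    qed simp
  qed
  moreover have "sym (?R\<^sup>*)"
    by (rule sym_rtrancl) (auto simp: sym_def insert_commute)
  ultimately have "(u, v) \<in> ?R\<^sup>*" if "u \<in> verts (chain m n)" "v \<in> verts (chain m n)" for u v
    using that by (meson rtrancl_trans symD)
  moreover have "verts (chain m n) \<noteq> {}"
    using assms by (auto simp: chain_def lessThan_empty_iff)
  ultimately show ?thesis
    unfolding connected_graph_def by blast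
qed

text \<open>A crude count: a block has at most 16 edges, each of the two filters in
  \<open>block_nbrs\<close> keeps at most these, and there are at most two connecting edges. What
  matters is a bound independent of \<open>m\<close> and \<open>n\<close>.\<close>

lemma max_degree_chain:
  assumes "0 < n"
  shows "max_degree (chain m n) \<le> 34"
proof -
  have "degree (chain m n) v \<le> 34" if vG: "v \<in> verts (chain m n)" for v
  proof -
    obtain i x where v: "v = 11 * i + x" "i < n" "x < 11"
      using chain_vertexE[OF vG] .
    have "length (block_edges (i < m)) \<le> 16"
      by (simp add: block_edges_def)
    then have "length (filter Q (block_edges (i < m))) \<le> 16" for Q
      using length_filter_le le_trans by blast
    from add_mono[OF this this] have "length (block_nbrs (i < m) x) \<le> 32"
      by (simp add: block_nbrs_def)
    moreover have "length (chain_nbrs m n i x) \<le> length (block_nbrs (i < m) x) + 2"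
      by (simp add: chain_nbrs_def)
    ultimately have "length (chain_nbrs m n i x) \<le> 34"
      by linarith
    then show ?thesis
      using card_image_le[of "set (chain_nbrs m n i x)"] card_length[of "chain_nbrs m n i x"] v(1)
      unfolding degree_def v(1) incident_chain[OF v(2,3)] by (meson List.finite_set le_trans)
  qed
  moreover have "verts (chain m n) \<noteq> {}" "finite (verts (chain m n))"
    using assms by (auto simp: chain_def lessThan_empty_iff)
  ultimately show ?thesis
    unfolding max_degree_def by simp
qed

section \<open>The two gadgets are obstructions\<close>

text \<open>Three cyclically consecutive colors have pairwise circular distance at most 2 modulo
  \<open>t\<close>.\<close>

lemma cyclic_interval_3_near:
  assumes "cyclic_interval t S" "card S = 3" "6 \<le> t" "a \<in> S" "b \<in> S"
  shows "\<bar>int a - int b\<bar> \<le> 2 \<or> int t - 2 \<le> \<bar>int a - int b\<bar>"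
proof -
  have S: "S \<subseteq> {1..t}" and "int_interval S \<or> int_interval ({1..t} - S)"
    using assms(1) by (auto simp: cyclic_interval_def)
  then consider x y where "S = {x..y}" | x y where "{1..t} - S = {x..y}"
    by (auto simp: int_interval_def)
  then show ?thesis
  proof cases
    case 1
    then show ?thesis using assms(2,4,5) by auto
  next
    case 2
    have "card ({1..t} - S) = t - 3"
      using S assms(2) by (simp add: card_Diff_subset finite_subset)
    then have len: "Suc y - x = t - 3"
      using 2 by simp
    \<comment> \<open>The complement has \<open>t - 3 \<ge> 3\<close> elements, so it is nonempty
      and its endpoints are colors.\<close>
    have "{x, y} \<subseteq> {1..t} - S"
      using 2 len assms(3) by auto
    then have "1 \<le> x" "y \<le> t"
      by auto
    moreover have "a \<notin> {x..y}" "b \<notin> {x..y}" "a \<in> {1..t}" "b \<in> {1..t}"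
      using 2 assms(4,5) S by auto
    ultimately show ?thesis
      using len assms(3) by auto
  qed
qed

text \<open>For colors in \<open>{1..t}\<close>: distinct and at circular distance at most 2.
  Integers keep the differences untruncated.\<close>

definition near :: "int \<Rightarrow> int \<Rightarrow> int \<Rightarrow> bool" where
  "near t a b \<longleftrightarrow> a \<noteq> b \<and> (\<bar>a - b\<bar> \<le> 2 \<or> t - 2 \<le> \<bar>a - b\<bar>)"

text \<open>The next lemmas concern the colors \<open>c, d\<close> of the edges from a neighbour of the subdivision vertex
  to the ends of the edge of color \<open>g\<close>, and the color \<open>a\<close> of its third edge: \<open>a\<close> is congruent to \<open>g\<close>
  or \<open>g \<plusminus> 3\<close> modulo \<open>t\<close>. The same holds for the other neighbour, but \<open>a\<close> and \<open>b\<close> meet at the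
  subdivision vertex.\<close>

lemma near_diamond:
  assumes "6 \<le> t" "{a,c,d,g} \<subseteq> {1..t}"
    "near t a c" "near t a d" "near t c d" "near t c g" "near t d g"
  shows "a = g \<or> \<bar>a - g\<bar> = 3 \<or> \<bar>a - g\<bar> = t - 3"
  using assms[unfolded near_def insert_subset atLeastAtMost_iff] by (smt (verit))

text \<open>Going from \<open>g\<close> to \<open>a\<close> in steps of one modulo \<open>t\<close>,
  the colors \<open>c\<close> and \<open>d\<close> lie strictly in between. From seven colors on,
  the two directions \<open>g + 3\<close> and \<open>g - 3\<close> differ.\<close>

lemma near_diamond_neq:
  assumes "7 \<le> t" "{a,c,d,g} \<subseteq> {1..t}"
    "near t a c" "near t a d" "near t c d" "near t c g" "near t d g" "a \<noteq> g"
  shows "(a - g = 3 \<or> a - g = 3 - t) \<and> (c - g = 1 \<or> c - g = 2 \<or> c - g = 1 - t \<or> c - g = 2 - t) \<and>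
      (d - g = 1 \<or> d - g = 2 \<or> d - g = 1 - t \<or> d - g = 2 - t) \<or>
    (g - a = 3 \<or> g - a = 3 - t) \<and> (g - c = 1 \<or> g - c = 2 \<or> g - c = 1 - t \<or> g - c = 2 - t) \<and>
      (g - d = 1 \<or> g - d = 2 \<or> g - d = 1 - t \<or> g - d = 2 - t)"
  using assms[unfolded near_def insert_subset atLeastAtMost_iff empty_subsetI simp_thms]
  by (smt (verit))

text \<open>As \<open>a\<close> and \<open>b\<close> are near, neither equals \<open>g\<close>, and
  they are \<open>g + 3\<close> and \<open>g - 3\<close> modulo \<open>t\<close>, which differ only
  if \<open>t \<ge> 7\<close>. Up to symmetry \<open>c, d\<close> are then
  \<open>g + 1, g + 2\<close> in some order, and \<open>e, f\<close> are
  \<open>g - 1, g - 2\<close>. But \<open>g + 2\<close> is near neither of the latter, although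
  \<open>c\<close> is near \<open>e\<close> and \<open>d\<close> is near \<open>f\<close>.\<close>

lemma not_near_cubic:
  assumes t: "6 \<le> t" and range: "{a,b,c,d,e,f,g} \<subseteq> {1..t}"
    and near: "near t a b" "near t a c" "near t a d" "near t c d"
      "near t b e" "near t b f" "near t e f"
      "near t c e" "near t c g" "near t e g"
      "near t d f" "near t d g" "near t f g"
  shows False
proof -
  have "a = g \<or> \<bar>a - g\<bar> = 3 \<or> \<bar>a - g\<bar> = t - 3" "b = g \<or> \<bar>b - g\<bar> = 3 \<or> \<bar>b - g\<bar> = t - 3"
    using near_diamond[of t a c d g] near_diamond[of t b e f g] t range near by simp_all
  then have neq: "a \<noteq> g" "b \<noteq> g" and "7 \<le> t"
    using near(1) range t unfolding near_def by auto
  have "{a,c,d,g} \<subseteq> {1..t}" "{b,e,f,g} \<subseteq> {1..t}"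
    using range by auto
  from near_diamond_neq[OF \<open>7 \<le> t\<close> this(1) near(2-4,9,12) neq(1)]
    near_diamond_neq[OF \<open>7 \<le> t\<close> this(2) near(5-7,10,13) neq(2)]
  show ?thesis
    using \<open>7 \<le> t\<close> range near(1,4,7,8,11)
    unfolding near_def insert_subset atLeastAtMost_iff empty_subsetI simp_thms by (smt (verit))
qed

section \<open>Residue classes modulo 4 and parity\<close>

text \<open>Passing from \<open>x\<close> to \<open>x + 1\<close> rotates the four summands.\<close>

lemma residues_4:
  fixes r x :: nat
  assumes "r < 4"
  shows "of_bool (x mod 4 = r) + of_bool ((x + 1) mod 4 = r) + of_bool ((x + 2) mod 4 = r) +
    of_bool ((x + 3) mod 4 = r) = (1::nat)"
proof (induction x)
  case 0
  have "r = 0 \<or> r = 1 \<or> r = 2 \<or> r = 3"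
    using assms by presburger
  then show ?case
    by auto
next
  case (Suc x)
  have *: "Suc x mod 4 = (x + 1) mod 4" "(Suc x + 1) mod 4 = (x + 2) mod 4"
      "(Suc x + 2) mod 4 = (x + 3) mod 4" "(Suc x + 3) mod 4 = x mod 4"
    by presburger+
  show ?case
    unfolding * using Suc.IH by linarith
qed

lemma int_interval_4_residues:
  assumes "int_interval {a,b,c,d}" "distinct [a,b,c,d]" "r < 4"
  shows "of_bool (a mod 4 = r) + of_bool (b mod 4 = r) + of_bool (c mod 4 = r) +
    of_bool (d mod 4 = r) = (1::nat)"
proof -
  obtain x y where xy: "{a,b,c,d} = {x..y}"
    using assms(1) by (auto simp: int_interval_def)
  have "card {a,b,c,d} = 4"
    using assms(2) by simp
  then have "y = x + 3"
    using xy by simp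
  have "(\<Sum>z\<in>{a,b,c,d}. of_bool (z mod 4 = r)) = (\<Sum>z=x..x+3. of_bool (z mod 4 = r) :: nat)"
    using xy \<open>y = x + 3\<close> by simp
  also have "{x..x+3} = {x, x+1, x+2, x+3}"
    by auto
  also have "(\<Sum>z\<in>{x, x+1, x+2, x+3}. of_bool (z mod 4 = r)) = (1::nat)"
    using residues_4[OF assms(3), of x] by (simp add: add.assoc del: sum_of_bool_eq)
  finally show ?thesis
    using assms(2) by (simp add: add.assoc del: sum_of_bool_eq)
qed

text \<open>Among five consecutive numbers only the class of the smallest occurs twice. Of the four
  classes, one differs both from it and from the class of \<open>e\<close>, which will be the color
  of the bridge.\<close>

lemma int_interval_5_residues:
  assumes "int_interval {a,b,c,d,e}" "distinct [a,b,c,d,e]"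
  obtains r where "r < 4" "e mod 4 \<noteq> r" 
    "of_bool (a mod 4 = r) + of_bool (b mod 4 = r) + of_bool (c mod 4 = r) +
      of_bool (d mod 4 = r) = (1::nat)"
proof -
  obtain x y where xy: "{a,b,c,d,e} = {x..y}"
    using assms(1) by (auto simp: int_interval_def)
  have "card {a,b,c,d,e} = 5"
    using assms(2) by simp
  then have y: "y = x + 4"
    using xy by simp
  obtain r where r: "r < 4" "r \<noteq> x mod 4" "r \<noteq> e mod 4"
  proof -
    have "\<exists>r<4. r \<noteq> u \<and> r \<noteq> v" for u v :: nat by presburger
    then show ?thesis using that by blast
  qed
  have "(\<Sum>z\<in>{a,b,c,d,e}. of_bool (z mod 4 = r)) = (\<Sum>z=x..x+4. of_bool (z mod 4 = r) :: nat)"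
    using xy y by simp
  also have "{x..x+4} = {x, x+1, x+2, x+3, x+4}"
    by auto
  also have "(\<Sum>z\<in>{x, x+1, x+2, x+3, x+4}. of_bool (z mod 4 = r)) = (1::nat)"
    using residues_4[OF r(1), of x] r(2) by (simp add: add.assoc del: sum_of_bool_eq)
  finally have "of_bool (a mod 4 = r) + of_bool (b mod 4 = r) + of_bool (c mod 4 = r) +
      of_bool (d mod 4 = r) = (1::nat)"
    using assms(2) r by (simp add: add.assoc del: sum_of_bool_eq)
  then show ?thesis using that r by blast
qed

(* The variables count the edges of one color class; each of the ten edges of K5 occurs twice. *)
lemma K5_parity:
  fixes a b c d e f g h i j :: nat
  assumes "a + b + c + d = 1" "e + f + g + a = 1" "h + i + b + e = 1" "j + c + f + h = 1"
    "d + g + i + j = 1"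
  shows False
proof -
  have "even ((a + b + c + d) + (e + f + g + a) + (h + i + b + e) + (j + c + f + h) + (d + g + i + j))"
    by presburger
  then show False
    unfolding assms by simp
qed

section \<open>A single block of a properly colored chain\<close>

lemma block_nbrs_gadget:
  "block_nbrs True 2 = [3,4,1]" "block_nbrs True 3 = [5,6,2]" "block_nbrs True 4 = [5,6,2]"
  "block_nbrs True 5 = [6,3,4]" "block_nbrs True 6 = [3,4,5]"
  "block_nbrs False 2 = [3,4,5,6,1]" "block_nbrs False 3 = [4,5,6,2]"
  "block_nbrs False 4 = [5,6,2,3]" "block_nbrs False 5 = [6,2,3,4]" "block_nbrs False 6 = [2,3,4,5]"
  by (simp_all add: block_nbrs_def block_edges_def)

definition block_color :: "(nat set \<Rightarrow> nat) \<Rightarrow> nat \<Rightarrow> nat \<Rightarrow> nat \<Rightarrow> nat" where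
  "block_color \<alpha> i x y = \<alpha> {11 * i + x, 11 * i + y}"

context
  fixes m n t i :: nat and \<alpha> :: "nat set \<Rightarrow> nat"
  assumes proper: "proper_edge_coloring (chain m n) t \<alpha>" and i: "i < n"
begin

lemma proper_chain:
  assumes "x < 11"
  shows "spectrum (chain m n) \<alpha> (11 * i + x) \<subseteq> {1..t}"
    and "inj_on (\<lambda>w. \<alpha> {11 * i + x, w}) (set (chain_nbrs m n i x))"
proof -
  have "\<alpha> ` edges (chain m n) \<subseteq> {1..t}"
      "\<forall>v\<in>verts (chain m n). inj_on \<alpha> {e \<in> edges (chain m n). v \<in> e}"
    using proper simple_chain[of m n] proper_edge_coloring_iff_inj_on[of "chain m n" t \<alpha>]
    unfolding simple_graph_def by blast+
  moreover have "11 * i + x \<in> verts (chain m n)"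
    using i assms by (simp add: chain_def)
  ultimately show "spectrum (chain m n) \<alpha> (11 * i + x) \<subseteq> {1..t}"
      "inj_on (\<lambda>w. \<alpha> {11 * i + x, w}) (set (chain_nbrs m n i x))"
    unfolding inj_on_chain_nbrs[OF i assms, symmetric] by (auto simp: spectrum_def)
qed

abbreviation "col \<equiv> block_color \<alpha> i"

lemma col_commute: "col x y = col y x"
  by (simp add: block_color_def insert_commute)

text \<open>Each instance puts the smaller end first, so that rewriting with them
  terminates.\<close>

lemmas gadget_col_commute = col_commute[of 3 2] col_commute[of 4 2] col_commute[of 5 2]
  col_commute[of 6 2] col_commute[of 4 3] col_commute[of 5 3] col_commute[of 6 3]
  col_commute[of 5 4] col_commute[of 6 4] col_commute[of 6 5]

lemma inj_on_col:
  assumes "x < 11"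
  shows "inj_on (col x) (set (block_nbrs (i < m) x))"
proof -
  have "inj_on ((\<lambda>w. \<alpha> {11 * i + x, w}) \<circ> (+) (11 * i)) (set (block_nbrs (i < m) x))"
    by (intro comp_inj_on inj_on_subset[OF proper_chain(2)[OF assms]]) (auto simp: chain_nbrs_def)
  then show ?thesis by (simp add: comp_def block_color_def[abs_def])
qed

lemma col_in_spectrum:
  assumes "x < 11" "y \<in> set (block_nbrs (i < m) x)"
  shows "col x y \<in> spectrum (chain m n) \<alpha> (11 * i + x)"
  unfolding spectrum_chain[OF i assms(1)] block_color_def using chain_nbrsI[OF assms(2)] by blast

lemma spectrum_gadget:
  assumes "2 \<le> x" "x < 11"
  shows "spectrum (chain m n) \<alpha> (11 * i + x) = col x ` set (block_nbrs (i < m) x)"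
  using assms by (simp add: spectrum_chain[OF i] chain_nbrs_def image_image block_color_def[abs_def])

text \<open>Vertex 1 has six neighbours within its block; the leaves 7 to 10 are attached for this
  purpose.\<close>

lemma six_colors: "6 \<le> t"
proof -
  have "set (block_nbrs (i < m) 1) = {0,2,7,8,9,10}"
    by (auto simp: block_nbrs_def block_edges_def)
  then have "inj_on (col 1) {0,2,7,8,9,10}"
    using inj_on_col[of 1] by simp
  then have "card (col 1 ` {0,2,7,8,9,10}) = 6"
    by (simp add: card_image)
  moreover have "col 1 ` {0,2,7,8,9,10} \<subseteq> spectrum (chain m n) \<alpha> (11 * i + 1)"
    unfolding \<open>set (block_nbrs (i < m) 1) = _\<close>[symmetric] by (intro image_subsetI col_in_spectrum) auto
  then have "col 1 ` {0,2,7,8,9,10} \<subseteq> {1..t}"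
    by (rule order_trans[OF _ proper_chain(1)]) simp
  then have "card (col 1 ` {0,2,7,8,9,10}) \<le> t"
    using card_mono[of "{1..t}"] by fastforce
  ultimately show ?thesis by simp
qed

lemma cubic_block_not_cyclic:
  assumes "i < m"
  shows "\<exists>v\<in>verts (chain m n). v div 11 = i \<and> \<not> cyclic_interval t (spectrum (chain m n) \<alpha> v)"
proof (rule ccontr)
  assume neg: "\<not> ?thesis"
  have cyc: "cyclic_interval t (spectrum (chain m n) \<alpha> (11 * i + x))" if "x < 11" for x
  proof -
    have "11 * i + x \<in> verts (chain m n)" "(11 * i + x) div 11 = i"
      using that i by (auto simp: chain_def)
    then show ?thesis using neg by blast
  qed
  have near: "near (int t) (int (col x y)) (int (col x z))"
    if "x \<in> {2,3,4,5,6}" "y \<in> set (block_nbrs True x)" "z \<in> set (block_nbrs True x)" "y \<noteq> z" for x y z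
  proof -
    have x: "2 \<le> x" "x < 11"
      using that(1) by auto
    have "card (set (block_nbrs True x)) = 3"
      using that(1) by (auto simp: block_nbrs_gadget)
    then have "card (spectrum (chain m n) \<alpha> (11 * i + x)) = 3"
      using inj_on_col[OF x(2)] assms by (simp add: spectrum_gadget[OF x] card_image)
    then have "\<bar>int (col x y) - int (col x z)\<bar> \<le> 2 \<or> int t - 2 \<le> \<bar>int (col x y) - int (col x z)\<bar>"
      using cyclic_interval_3_near[OF cyc[OF x(2)] _ six_colors] that(2,3) assms
      by (simp add: spectrum_gadget[OF x])
    moreover have "col x y \<noteq> col x z"
      using inj_on_col[OF x(2)] that assms by (auto dest: inj_onD)
    ultimately show ?thesis
      by (simp add: near_def)
  qed
  have range: "int (col x y) \<in> {1..int t}"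
    if "x \<in> {2,3,4,5,6}" "y \<in> set (block_nbrs True x)" for x y
    using proper_chain(1)[of x] spectrum_gadget[of x] that assms by fastforce
  show False
  \<comment> \<open>Vertex 2 subdivides the edge between 3 and 4 of a \<open>K\<^sub>4\<close> on 3,
    4, 5, 6. Its two halves take the roles of \<open>a\<close> and \<open>b\<close>, and the
    opposite edge between 5 and 6 that of \<open>g\<close>.\<close>
  proof (rule not_near_cubic)
    show "6 \<le> int t" using six_colors by simp
    show "{int (col 2 3), int (col 2 4), int (col 3 5), int (col 3 6), int (col 4 5), int (col 4 6), int (col 5 6)}
      \<subseteq> {1..int t}"
      using range by (simp add: block_nbrs_gadget)
  qed (use near[of 2 3 4] near[of 3 2 5] near[of 3 2 6] near[of 3 5 6] near[of 4 2 5] near[of 4 2 6]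
      near[of 4 5 6] near[of 5 3 4] near[of 5 3 6] near[of 5 4 6] near[of 6 3 4] near[of 6 3 5]
      near[of 6 4 5] in \<open>simp_all add: block_nbrs_gadget gadget_col_commute\<close>)
qed

lemma K5_block_not_interval:
  assumes "\<not> i < m"
  shows "\<exists>v\<in>verts (chain m n). v div 11 = i \<and> \<not> int_interval (spectrum (chain m n) \<alpha> v)"
proof (rule ccontr)
  assume neg: "\<not> ?thesis"
  have ivl: "int_interval (col x ` set (block_nbrs False x))" if "x \<in> {2,3,4,5,6}" for x
  proof -
    have "11 * i + x \<in> verts (chain m n)" "(11 * i + x) div 11 = i"
      using that i by (auto simp: chain_def)
    then have "int_interval (spectrum (chain m n) \<alpha> (11 * i + x))"
      using neg by blast
    then show ?thesis using that spectrum_gadget[of x] assms by auto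
  qed
  have dist: "distinct (map (col x) (block_nbrs False x))" if "x \<in> {2,3,4,5,6}" for x
    using inj_on_col[of x] that assms by (auto simp: distinct_map block_nbrs_gadget)
  let ?k = "\<lambda>x y r. of_bool (col x y mod 4 = r) :: nat"
  have "int_interval {col 2 3, col 2 4, col 2 5, col 2 6, col 2 1}"
    using ivl[of 2] by (simp add: block_nbrs_gadget)
  moreover have "distinct [col 2 3, col 2 4, col 2 5, col 2 6, col 2 1]"
    using dist[of 2] by (simp add: block_nbrs_gadget)
  ultimately obtain r where r: "r < 4" "col 2 1 mod 4 \<noteq> r"
    "?k 2 3 r + ?k 2 4 r + ?k 2 5 r + ?k 2 6 r = 1"
    by (rule int_interval_5_residues)
  have v: "?k x a r + ?k x b r + ?k x c r + ?k x d r = 1"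
    if "x \<in> {2,3,4,5,6}" "block_nbrs False x = [a,b,c,d]" for x a b c d
  proof (rule int_interval_4_residues[OF _ _ r(1)])
    show "int_interval {col x a, col x b, col x c, col x d}"
      using ivl[OF that(1)] unfolding that(2) by simp
    show "distinct [col x a, col x b, col x c, col x d]"
      using dist[OF that(1)] unfolding that(2) by simp
  qed
  \<comment> \<open>Since \<open>r\<close> avoids the bridge, the edges with color in class
    \<open>r\<close> cover each of the five vertices exactly once. The order of the neighbour lists
    gives the sums the shape required by \<open>K5_parity\<close>.\<close>
  have "?k 3 4 r + ?k 3 5 r + ?k 3 6 r + ?k 2 3 r = 1"
      "?k 4 5 r + ?k 4 6 r + ?k 2 4 r + ?k 3 4 r = 1"
      "?k 5 6 r + ?k 2 5 r + ?k 3 5 r + ?k 4 5 r = 1"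
      "?k 2 6 r + ?k 3 6 r + ?k 4 6 r + ?k 5 6 r = 1"
    using v[OF _ block_nbrs_gadget(7)] v[OF _ block_nbrs_gadget(8)]
      v[OF _ block_nbrs_gadget(9)] v[OF _ block_nbrs_gadget(10)]
    unfolding gadget_col_commute by blast+
  with r(3) show False
    by (rule K5_parity)
qed

end

section \<open>Colorings\<close>

text \<open>Colors of the edges in the order of \<open>block_edges\<close>. The first two lists leave room for a pendant
  edge of color 4 at vertex 2; the third one is cyclic modulo 7. Connecting edges get color 1.\<close>

definition cubic_colors :: "nat list" where
  "cubic_colors = [2,3,4,5,6,7] @ [2,5,1,3,3,4,2]"

definition K5_interval_colors :: "nat list" where
  "K5_interval_colors = [2,3,4,5,6,7] @ [1,2,5,6,3,2,4,4,5,3]"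

definition K5_cyclic_colors :: "nat list" where
  "K5_cyclic_colors = [2,3,4,5,6,7] @ [1,2,4,5,6,5,7,7,1,6]"

definition edge_color :: "bool \<Rightarrow> nat list \<Rightarrow> nat \<Rightarrow> nat \<Rightarrow> nat" where
  "edge_color b cs x y = the (map_of (zip (block_edges b) cs) (min x y, max x y))"

text \<open>The two ends are recovered as \<open>Min e\<close> and \<open>Max e\<close>; an edge
  connects different blocks iff these have different quotients by 11.\<close>

definition chain_coloring :: "nat \<Rightarrow> (nat \<Rightarrow> nat list) \<Rightarrow> nat set \<Rightarrow> nat" where
  "chain_coloring m cs e = (let i = Min e div 11 in
     if Max e div 11 = i then edge_color (i < m) (cs i) (Min e mod 11) (Max e mod 11) else 1)"

definition nbr_colors :: "bool \<Rightarrow> nat list \<Rightarrow> bool \<Rightarrow> bool \<Rightarrow> nat \<Rightarrow> nat list" where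
  "nbr_colors b cs pred succ x = map (edge_color b cs x) (block_nbrs b x) @
     (if x = 1 \<and> succ then [1] else []) @ (if x = 0 \<and> pred then [1] else [])"

text \<open>A finite check that can be evaluated: eleven positions, with or without a previous and a
  next block. It does not depend on the place of the block in the chain.\<close>

definition block_ok :: "(nat list \<Rightarrow> bool) \<Rightarrow> bool \<Rightarrow> nat list \<Rightarrow> bool \<Rightarrow> bool" where
  "block_ok Q b cs pendant \<longleftrightarrow> list_all (\<lambda>x. list_all (\<lambda>(pred, succ).
     let l = (if x = 2 \<and> pendant then [4] else []) @ nbr_colors b cs pred succ x in
     distinct l \<and> list_all (\<lambda>c. 1 \<le> c \<and> c \<le> 7) l \<and> Q l)
     [(True, True), (True, False), (False, True), (False, False)]) [0..<11]"

text \<open>An evaluable test that mentions no endpoints. Distinct numbers within a window of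
  \<open>length l\<close> values starting at their minimum fill this window.\<close>

definition interval_list :: "nat list \<Rightarrow> bool" where
  "interval_list l \<longleftrightarrow> list_all (\<lambda>c. list_all (\<lambda>d. c < d + length l) l) l"

definition cyclic_interval_list :: "nat list \<Rightarrow> bool" where
  "cyclic_interval_list l \<longleftrightarrow>
     interval_list l \<or> interval_list (filter (\<lambda>c. c \<notin> set l) [1..<8])"

lemma int_interval_empty: "int_interval {}"
  unfolding int_interval_def by (intro exI[of _ 1] exI[of _ 0]) simp

lemma int_interval_set:
  assumes "distinct l" "interval_list l"
  shows "int_interval (set l)"
proof (cases "l = []")
  case False
  define a where "a = Min (set l)"
  have "a \<in> set l" "\<And>c. c \<in> set l \<Longrightarrow> a \<le> c"
    using False by (simp_all add: a_def)
  then have "set l \<subseteq> {a..<a + length l}"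
    using assms(2) unfolding interval_list_def list_all_iff by auto
  moreover have "card (set l) = card {a..<a + length l}"
    using assms(1) by (simp add: distinct_card)
  ultimately have "set l = {a..<a + length l}"
    by (simp add: card_subset_eq)
  also have "\<dots> = {a..a + length l - 1}"
    using False by (cases l) auto
  finally show ?thesis
    unfolding int_interval_def by blast
qed (simp add: int_interval_empty)

lemma cyclic_interval_set:
  assumes "distinct l" "set l \<subseteq> {1..7}" "cyclic_interval_list l"
  shows "cyclic_interval 7 (set l)"
proof -
  have "set (filter (\<lambda>c. c \<notin> set l) [1..<8]) = {1..7} - set l"
    by auto
  then show ?thesis
    using assms int_interval_set[of l] int_interval_set[of "filter (\<lambda>c. c \<notin> set l) [1..<8]"]
    unfolding cyclic_interval_def cyclic_interval_list_def by auto
qed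

lemma block_ok_cubic: "block_ok interval_list True cubic_colors True"
  by code_simp

lemma block_ok_K5_interval: "block_ok interval_list False K5_interval_colors True"
  by code_simp

lemma block_ok_K5_cyclic: "block_ok cyclic_interval_list False K5_cyclic_colors False"
  by code_simp

lemma block_ok_mono:
  assumes "block_ok Q b cs pendant" "\<And>l. Q l \<Longrightarrow> Q' l"
  shows "block_ok Q' b cs pendant"
  using assms unfolding block_ok_def Let_def list_all_iff by auto

lemma block_okD:
  assumes "block_ok Q b cs pendant" "x < 11"
    and "l = (if x = 2 \<and> pendant then [4] else []) @ nbr_colors b cs pred succ x"
  shows "distinct l \<and> set l \<subseteq> {1..7} \<and> Q l"
proof -
  have "x \<in> set [0..<11]"
    "(pred, succ) \<in> set [(True, True), (True, False), (False, True), (False, False)]"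
    using assms(2) by auto
  then show ?thesis
    using assms(1) unfolding block_ok_def assms(3) Let_def list_all_iff by fastforce
qed

lemma chain_coloring_block:
  assumes "x < 11" "y < 11"
  shows "chain_coloring m cs {11 * i + x, 11 * i + y} = edge_color (i < m) (cs i) x y"
proof (cases "x \<le> y")
  case True
  then have "Min {11 * i + x, 11 * i + y} = 11 * i + x" "Max {11 * i + x, 11 * i + y} = 11 * i + y"
    by simp_all
  then show ?thesis
    using assms unfolding chain_coloring_def by simp
next
  case False
  then have "Min {11 * i + x, 11 * i + y} = 11 * i + y" "Max {11 * i + x, 11 * i + y} = 11 * i + x"
    by simp_all
  then show ?thesis
    using assms unfolding chain_coloring_def edge_color_def by (simp add: min.commute max.commute)
qed

lemma chain_coloring_link: "chain_coloring m cs {11 * i + 1, 11 * i + 11} = 1"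
proof -
  have "(11 * i + 11) div 11 = i + 1" "(11 * i + 1) div 11 = i"
    by presburger+
  then show ?thesis
    by (simp add: chain_coloring_def)
qed

lemma map_chain_coloring:
  assumes "x < 11"
  shows "map (\<lambda>w. chain_coloring m cs {11 * i + x, w}) (chain_nbrs m n i x) =
    nbr_colors (i < m) (cs i) (0 < i) (Suc i < n) x"
proof -
  have "map (\<lambda>y. chain_coloring m cs {11 * i + x, 11 * i + y}) (block_nbrs (i < m) x) =
      map (edge_color (i < m) (cs i) x) (block_nbrs (i < m) x)"
    using assms block_nbrs_less by (simp add: chain_coloring_block)
  moreover have "chain_coloring m cs {11 * i, 11 * i - 10} = 1" if "0 < i"
  proof -
    from gr0_implies_Suc[OF that] obtain j where "i = Suc j"
      by blast
    then show ?thesis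
      using chain_coloring_link[of m cs j] by (simp add: insert_commute add.commute)
  qed
  ultimately show ?thesis
    using chain_coloring_link[of m cs i] chain_coloring_link[of m cs 0]
    by (simp add: chain_nbrs_def nbr_colors_def comp_def)
qed

text \<open>The upper bound for both deficiencies: seven colors, and a pendant edge of color 4 at
  vertex 2 of each of the first \<open>k\<close> blocks.\<close>

lemma completable_chain:
  assumes ok: "\<And>i. i < n \<Longrightarrow> block_ok Q (i < m) (cs i) (i < k)"
    and P: "\<And>l. distinct l \<Longrightarrow> set l \<subseteq> {1..7} \<Longrightarrow> Q l \<Longrightarrow> P 7 (set l)"
    and "P 7 {4}" "k \<le> n"
  shows "completable P (chain m n) k"
proof (rule completableI)
  let ?\<alpha> = "chain_coloring m cs"
  \<comment> \<open>All colors at a vertex after the attachment. That this list is distinct yields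
    properness and also that color 4 was free.\<close>
  let ?l = "\<lambda>i x. (if x = 2 \<and> i < k then [4] else []) @ nbr_colors (i < m) (cs i) (0 < i) (Suc i < n) x"
  have l: "distinct (?l i x) \<and> set (?l i x) \<subseteq> {1..7} \<and> Q (?l i x)" if "i < n" "x < 11" for i x
    by (rule block_okD[OF ok[OF that(1)] that(2) refl])
  have spec: "spectrum (chain m n) ?\<alpha> (11 * i + x) =
      set (nbr_colors (i < m) (cs i) (0 < i) (Suc i < n) x)" if "i < n" "x < 11" for i x
    by (simp only: spectrum_chain[OF that] map_chain_coloring[OF that(2), symmetric] set_map)
  show "simple_graph (chain m n)"
    by (rule simple_chain)
  show "proper_edge_coloring (chain m n) 7 ?\<alpha>"
  proof (rule proper_edge_coloring_iff_inj_on[THEN iffD2], goal_cases)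
    case 2
    have "inj_on ?\<alpha> {e \<in> edges (chain m n). v \<in> e}" if vG: "v \<in> verts (chain m n)" for v
    proof -
      obtain i x where v: "v = 11 * i + x" "i < n" "x < 11"
        using chain_vertexE[OF vG] .
      then show ?thesis
        using l[OF v(2,3)] unfolding v(1) inj_on_chain_nbrs[OF v(2,3)]
          map_chain_coloring[OF v(3), symmetric] by (auto simp: distinct_map)
    qed
    moreover have "?\<alpha> e \<in> {1..7}" if eG: "e \<in> edges (chain m n)" for e
    proof -
      have "e \<noteq> {}" "e \<subseteq> verts (chain m n)"
        using simple_chain[of m n] eG unfolding simple_graph_def by auto
      then obtain v where ve: "v \<in> e" "v \<in> verts (chain m n)"
        by blast
      then obtain i x where v: "v = 11 * i + x" "i < n" "x < 11"
        using chain_vertexE by blast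
      have "?\<alpha> e \<in> spectrum (chain m n) ?\<alpha> v"
        using eG ve(1) by (auto simp: spectrum_def)
      then show ?thesis
        using l[OF v(2,3)] unfolding v(1) spec[OF v(2,3)] by auto
    qed
    ultimately show ?case
      by blast
  qed (use simple_chain[of m n] in \<open>auto simp: simple_graph_def\<close>)
  show "11 * i + 2 \<in> verts (chain m n)" if "i < k" for i
    using that \<open>k \<le> n\<close> by (simp add: chain_def)
  show "inj_on (\<lambda>i. 11 * i + 2) {..<k}"
    by (simp add: inj_on_def)
  show "(4 :: nat) \<in> {1..7}"
    by simp
  show "4 \<notin> spectrum (chain m n) ?\<alpha> (11 * i + 2)" if "i < k" for i
    using l[of i 2] spec[of i 2] that \<open>k \<le> n\<close> by auto
  show "P 7 (spectrum (chain m n) ?\<alpha> v \<union> (if v \<in> (\<lambda>i. 11 * i + 2) ` {..<k} then {4} else {}))"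
    if vG: "v \<in> verts (chain m n)" for v
  proof -
    obtain i x where v: "v = 11 * i + x" "i < n" "x < 11"
      using chain_vertexE[OF vG] .
    have eq: "11 * i + x = 11 * j + 2 \<longleftrightarrow> i = j \<and> x = 2" for j
      by (rule block_index_eq) (use v(3) in simp_all)
    have "11 * i + x \<in> (\<lambda>i. 11 * i + 2) ` {..<k} \<longleftrightarrow> x = 2 \<and> i < k"
      unfolding image_iff Bex_def lessThan_iff eq by blast
    then have "spectrum (chain m n) ?\<alpha> v \<union> (if v \<in> (\<lambda>i. 11 * i + 2) ` {..<k} then {4} else {}) =
        set (?l i x)"
      unfolding v(1) spec[OF v(2,3)] by auto
    then show ?thesis
      using P l[OF v(2,3)] by presburger
  qed
  show "P 7 {4}"
    by fact
qed

section \<open>The values of the two deficiencies\<close>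

text \<open>Both gadgets obstruct interval colorings, so each of the \<open>n\<close> blocks
  requires a pendant edge of its own, and one per block suffices.\<close>

lemma deficiency_chain: "deficiency (chain m n) = n"
  unfolding deficiency_completable
proof (rule Least_equality)
  show "completable (\<lambda>_. int_interval) (chain m n) n"
  proof (rule completable_chain)
    show "block_ok interval_list (i < m) (if i < m then cubic_colors else K5_interval_colors) (i < n)"
      if "i < n" for i
      using that block_ok_cubic block_ok_K5_interval by auto
    show "int_interval {4}"
      unfolding int_interval_def by (intro exI[of _ 4]) simp
  qed (auto intro: int_interval_set)
next
  fix k
  assume k: "completable (\<lambda>_. int_interval) (chain m n) k"
  have bad: "\<exists>v\<in>verts (chain m n). v div 11 = i \<and> \<not> int_interval (spectrum (chain m n) \<alpha> v)"
    if proper: "proper_edge_coloring (chain m n) t \<alpha>" and i: "i < n" for t \<alpha> i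
  proof (cases "i < m")
    case True
    then obtain v where v: "v \<in> verts (chain m n)" "v div 11 = i"
      "\<not> cyclic_interval t (spectrum (chain m n) \<alpha> v)"
      using cubic_block_not_cyclic[OF proper i] by blast
    \<comment> \<open>An interval contained in \<open>{1..t}\<close> is a cyclic interval, so the
      cubic block also obstructs interval colorings.\<close>
    moreover have "spectrum (chain m n) \<alpha> v \<subseteq> {1..t}"
      using proper unfolding proper_edge_coloring_def spectrum_def by blast
    ultimately show ?thesis
      unfolding cyclic_interval_def by blast
  next
    case False
    then show ?thesis
      using K5_block_not_interval[OF proper i] by blast
  qed
  show "n \<le> k"
    using k not_completable[of "chain m n" n "\<lambda>v. v div 11" "\<lambda>_. int_interval" k] bad
    by (meson not_less)
qed

text \<open>Only the \<open>m\<close> cubic blocks obstruct; the others are colored cyclically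
  modulo 7 without pendant edges.\<close>

lemma cyclic_deficiency_chain:
  assumes "m \<le> n"
  shows "cyclic_deficiency (chain m n) = m"
  unfolding cyclic_deficiency_completable
proof (rule Least_equality)
  show "completable cyclic_interval (chain m n) m"
  proof (rule completable_chain)
    show "block_ok cyclic_interval_list (i < m) (if i < m then cubic_colors else K5_cyclic_colors) (i < m)"
      for i
      using block_ok_mono[OF block_ok_cubic, of cyclic_interval_list] block_ok_K5_cyclic
      by (auto simp: cyclic_interval_list_def)
    show "cyclic_interval 7 {4}"
      using cyclic_interval_set[of "[4]"] by (simp add: cyclic_interval_list_def interval_list_def)
  qed (use assms in \<open>auto intro!: cyclic_interval_set simp del: One_nat_def\<close>)
next
  fix k
  assume k: "completable cyclic_interval (chain m n) k"
  have bad: "\<exists>v\<in>verts (chain m n). v div 11 = i \<and> \<not> cyclic_interval t (spectrum (chain m n) \<alpha> v)"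
    if "proper_edge_coloring (chain m n) t \<alpha>" "i < m" for t \<alpha> i
    using cubic_block_not_cyclic[OF that(1) _ that(2)] that(2) assms by simp
  show "m \<le> k"
    using k not_completable[of "chain m n" m "\<lambda>v. v div 11" cyclic_interval k] bad
    by (meson not_less)
qed

theorem theorem5:
  "\<exists>D::nat. \<forall>m n::nat. 0 < m \<and> m \<le> n \<longrightarrow>
     (\<exists>G :: nat graph. simple_graph G \<and> connected_graph G \<and> max_degree G \<le> D \<and>
        cyclic_deficiency G = m \<and> deficiency G = n)"
proof (intro exI[of _ 34] allI impI)
  fix m n :: nat
  assume mn: "0 < m \<and> m \<le> n"
  then have "0 < n"
    by simp
  show "\<exists>G :: nat graph. simple_graph G \<and> connected_graph G \<and> max_degree G \<le> 34 \<and>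
      cyclic_deficiency G = m \<and> deficiency G = n"
    using simple_chain connected_chain[OF \<open>0 < n\<close>] max_degree_chain[OF \<open>0 < n\<close>]
      cyclic_deficiency_chain[of m n] deficiency_chain mn by blast
qed

end
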